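(* Let $Y$ be a Poisson random variable with parameter $\alpha>0$, let $Y_1,Y_2,\dots$ be i.i.d. copies of $Y$, and $S_k=Y_1+\cdots+Y_k$ ($S_0=0$). Then for all integers $k\ge 0$ and $n\ge 0$, $$E\big[\langle S_{k}\rangle_{n,\lambda}\big]=E\big[\langle Y_{1}+Y_{2}+\cdots+Y_{k}\rangle_{n,\lambda}\big]=H_{n,\lambda}(k\alpha).$$
   Context: Fix a nonzero real $\lambda$. Put $\langle x\rangle_{0,\lambda}=1$, $\langle x\rangle_{n,\lambda}=x(x+\lambda)\cdots(x+(n-1)\lambda)$ for $n\ge1$, and $e_\lambda^{-1}(-t)=(1-\lambda t)^{-1/\lambda}$. The heterogeneous Bell polynomials $H_{n,\lambda}(x)$ are defined by $e^{x(e_{\lambda}^{-1}(-t)-1)}=\sum_{n\ge0}H_{n,\lambda}(x)\frac{t^{n}}{n!}$. *)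

theory Defs
  imports "HOL-Probability.Probability"
    "HOL-Computational_Algebra.Formal_Power_Series"
begin

unbundle fps_syntax

definition deg_rising_fact :: "real \<Rightarrow> real \<Rightarrow> nat \<Rightarrow> real" where
  "deg_rising_fact l x n = (\<Prod>i<n. x + real i * l)"

text \<open>
  The formal power series in \<open>t\<close> of \<open>(1 - l t) powr (- 1 / l)\<close>: the binomial series
  \<open>(1 + u) powr (- 1 / l)\<close> at \<open>u = - l t\<close>.
\<close>

definition deg_exp_inv_neg_fps :: "real \<Rightarrow> real fps" where
  "deg_exp_inv_neg_fps l = fps_binomial (- 1 / l) oo (fps_const (- l) * fps_X)"

lemma deg_exp_inv_neg_fps_sums:
  assumes "\<bar>l * t\<bar> < 1"
  shows "(\<lambda>n. deg_exp_inv_neg_fps l $ n * t ^ n) sums ((1 - l * t) powr (- 1 / l))"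
proof -
  have "(\<lambda>n. ((- 1 / l) gchoose n) * (- (l * t)) ^ n) sums ((1 + (- (l * t))) powr (- 1 / l))"
    by (rule gen_binomial_real) (use assms in simp)
  moreover have "deg_exp_inv_neg_fps l $ n * t ^ n = ((- 1 / l) gchoose n) * (- (l * t)) ^ n" for n
  proof -
    have "(- (l * t)) ^ n = (- l) ^ n * t ^ n"
      by (simp flip: power_mult_distrib)
    thus ?thesis
      unfolding deg_exp_inv_neg_fps_def by (simp add: fps_compose_linear)
  qed
  ultimately show ?thesis by simp
qed

lemma deg_exp_inv_neg_fps_nth_0: "deg_exp_inv_neg_fps l $ 0 = 1"
  by (simp add: deg_exp_inv_neg_fps_def)

text \<open>
  The composition below is the formal series of \<open>exp (x * ((1 - l t) powr (- 1 / l) - 1))\<close>;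
  it is a genuine substitution since the inner series has constant term \<open>0\<close>.
\<close>

definition hetero_bell :: "nat \<Rightarrow> real \<Rightarrow> real \<Rightarrow> real" where
  "hetero_bell n l x = fact n * (fps_exp x oo (deg_exp_inv_neg_fps l - 1)) $ n"

lemma hetero_bell_gen_fun:
  "Abs_fps (\<lambda>n. hetero_bell n l x / fact n) = fps_exp x oo (deg_exp_inv_neg_fps l - 1)"
  by (simp add: fps_eq_iff hetero_bell_def)

end

theory Submission
  imports Defs
begin

text \<open>
  With \<open>F\<close> the series of \<open>(1 - l t) powr (- 1 / l)\<close> and \<open>G = F - 1\<close>, the degenerate rising
  factorial of a natural number \<open>m\<close> is \<open>n!\<close> times the \<open>n\<close>-th coefficient of
  \<open>F ^ m = (1 + G) ^ m\<close>, so it is a fixed finite linear combination of the binomial coefficients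
  \<open>m choose j\<close>, \<open>j \<le> n\<close>. The binomial moments of a sum of \<open>k\<close> independent Poisson variables are
  \<open>(k \<alpha>) ^ j / j!\<close>, by Vandermonde's identity and the binomial theorem; substituting them yields
  the coefficients of \<open>exp (k \<alpha> G)\<close>.
\<close>

text \<open>Powers of a binomial series multiply its exponent, so the \<open>m\<close>-th power has
  exponent \<open>- m / l\<close>. Each of the \<open>n\<close> factors \<open>- m / l - i\<close>
  of its coefficient then absorbs one factor \<open>- l\<close> from the substitution and becomes
  \<open>m + i * l\<close>.\<close>

lemma deg_exp_inv_neg_fps_power_nth:
  assumes "l \<noteq> 0"
  shows "fact n * (deg_exp_inv_neg_fps l ^ m) $ n = deg_rising_fact l (real m) n"
proof -
  have "deg_exp_inv_neg_fps l ^ m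
      = fps_binomial (real m * (- 1 / l)) oo (fps_const (- l) * fps_X)"
    unfolding deg_exp_inv_neg_fps_def by (simp add: fps_compose_power fps_binomial_power)
  hence "fact n * (deg_exp_inv_neg_fps l ^ m) $ n
      = (- l) ^ n * (\<Prod>i = 0..<n. real m * (- 1 / l) - real i)"
    by (simp only: fps_compose_linear) (simp add: gbinomial_prod_rev)
  also have "\<dots> = (\<Prod>i = 0..<n. (- l) * (real m * (- 1 / l) - real i))"
    by (subst prod.distrib) simp
  also have "\<dots> = deg_rising_fact l (real m) n"
    unfolding deg_rising_fact_def atLeast0LessThan
    by (rule prod.cong) (use assms in \<open>simp_all add: field_simps\<close>)
  finally show ?thesis .
qed

text \<open>The range of \<open>j\<close> and the coefficients do not depend on \<open>m\<close>, so
  the identity can be integrated term by term when \<open>m\<close> is random.\<close>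

lemma deg_rising_fact_of_nat_conv_binomial:
  assumes "l \<noteq> 0"
  shows "deg_rising_fact l (real m) n
    = (\<Sum>j\<le>n. fact n * ((deg_exp_inv_neg_fps l - 1) ^ j) $ n * (real m gchoose j))"
proof -
  define G where "G = deg_exp_inv_neg_fps l - 1"
  have G0: "G $ 0 = 0"
    by (simp add: G_def deg_exp_inv_neg_fps_nth_0)
  have "(deg_exp_inv_neg_fps l ^ m) $ n = ((G + 1) ^ m) $ n"
    by (simp add: G_def)
  also have "\<dots> = (\<Sum>j\<le>m. real (m choose j) * (G ^ j) $ n)"
    by (simp add: binomial_ring fps_sum_nth flip: fps_of_nat)
  \<comment> \<open>Enlarging to a common range allows both cutoffs: \<open>m choose j\<close>
    vanishes for \<open>j > m\<close>, and the coefficient of \<open>G ^ j\<close> vanishes for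
    \<open>j > n\<close> because \<open>G\<close> has constant term 0.\<close>
  also have "\<dots> = (\<Sum>j\<le>max m n. real (m choose j) * (G ^ j) $ n)"
    by (rule sum.mono_neutral_left) (auto simp: binomial_eq_0)
  also have "\<dots> = (\<Sum>j\<le>n. real (m choose j) * (G ^ j) $ n)"
    by (rule sum.mono_neutral_right) (use startsby_zero_power_prefix[OF G0] in auto)
  finally have "fact n * (deg_exp_inv_neg_fps l ^ m) $ n
      = (\<Sum>j\<le>n. fact n * (G ^ j) $ n * (real m gchoose j))"
    by (simp add: sum_distrib_left binomial_gbinomial mult_ac)
  thus ?thesis
    by (simp add: deg_exp_inv_neg_fps_power_nth[OF assms] G_def)
qed

text \<open>Cancelling factorials in the term of index \<open>i + j\<close> leaves a constant times
  \<alpha>^i / i!, so an exponential series remains.\<close>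

lemma poisson_binomial_moment:
  assumes "\<alpha> > 0"
  shows "has_bochner_integral (measure_pmf (poisson_pmf \<alpha>)) (\<lambda>m. real m gchoose j)
    (\<alpha> ^ j / fact j)"
proof -
  define f where "f = (\<lambda>m. pmf (poisson_pmf \<alpha>) m * (real m gchoose j))"
  have f_nonneg: "f m \<ge> 0" for m
    by (simp add: f_def flip: binomial_gbinomial)
  have "(\<lambda>i. (\<alpha> ^ j / fact j * exp (- \<alpha>)) * (\<alpha> ^ i /\<^sub>R fact i)) sums
      ((\<alpha> ^ j / fact j * exp (- \<alpha>)) * exp \<alpha>)"
    by (intro sums_mult exp_converges)
  moreover have "(\<alpha> ^ j / fact j * exp (- \<alpha>)) * (\<alpha> ^ i /\<^sub>R fact i) = f (i + j)" for i
    using assms binomial_fact[of j "i + j", where 'a = real]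
    by (simp add: f_def power_add field_simps flip: binomial_gbinomial)
  moreover have "(\<alpha> ^ j / fact j * exp (- \<alpha>)) * exp \<alpha> = \<alpha> ^ j / fact j"
    by (simp add: exp_minus)
  ultimately have "(\<lambda>i. f (i + j)) sums (\<alpha> ^ j / fact j)"
    by (simp only:)
  moreover have "f m = 0" if "m < j" for m
    using that by (simp add: f_def binomial_eq_0 flip: binomial_gbinomial)
  ultimately have f_sums: "f sums (\<alpha> ^ j / fact j)"
    by (simp add: sums_iff_shift)
  \<comment> \<open>Nonnegativity turns summability into absolute summability.\<close>
  hence "integrable (count_space UNIV) f"
    using f_nonneg by (simp add: integrable_count_space_nat_iff sums_iff)
  with f_sums have "has_bochner_integral (count_space UNIV) f (\<alpha> ^ j / fact j)"
    using sums_integral_count_space_nat sums_unique2 by (metis has_bochner_integral_iff)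
  thus ?thesis
    unfolding measure_pmf_eq_density f_def
    by (intro has_bochner_integral_density) simp_all
qed

lemma power_over_fact_add:
  fixes a b :: real
  shows "(\<Sum>i\<le>j. (a ^ i / fact i) * (b ^ (j - i) / fact (j - i))) = (a + b) ^ j / fact j"
proof -
  have "(a + b) ^ j / fact j = (\<Sum>i\<le>j. real (j choose i) * a ^ i * b ^ (j - i) / fact j)"
    by (simp add: binomial_ring sum_divide_distrib)
  also have "\<dots> = (\<Sum>i\<le>j. (a ^ i / fact i) * (b ^ (j - i) / fact (j - i)))"
    by (rule sum.cong) (simp_all add: binomial_fact)
  finally show ?thesis ..
qed

text \<open>Vandermonde's identity splits the binomial coefficient of the sum into products, whose
  expectations factor by independence; the resulting convolution is the binomial theorem divided by
  \<open>j!\<close>.\<close>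

lemma (in prob_space) binomial_moment_add_indep:
  fixes X Z :: "'a \<Rightarrow> real"
  assumes indep: "indep_var borel X borel Z"
    and X: "\<And>i. has_bochner_integral M (\<lambda>\<omega>. X \<omega> gchoose i) (a ^ i / fact i)"
    and Z: "\<And>i. has_bochner_integral M (\<lambda>\<omega>. Z \<omega> gchoose i) (b ^ i / fact i)"
  shows "has_bochner_integral M (\<lambda>\<omega>. (X \<omega> + Z \<omega>) gchoose j) ((a + b) ^ j / fact j)"
proof -
  have meas: "(\<lambda>x::real. x gchoose i) \<in> borel_measurable borel" for i
    by (simp add: gbinomial_prod_rev)
  have "has_bochner_integral M (\<lambda>\<omega>. (X \<omega> gchoose i) * (Z \<omega> gchoose (j - i)))
      ((a ^ i / fact i) * (b ^ (j - i) / fact (j - i)))" for i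
  proof -
    have "indep_var borel (\<lambda>\<omega>. X \<omega> gchoose i) borel (\<lambda>\<omega>. Z \<omega> gchoose (j - i))"
      using indep_var_compose[OF indep meas meas] by (simp add: comp_def)
    thus ?thesis
      using X[of i] Z[of "j - i"]
      by (simp add: has_bochner_integral_iff indep_var_integrable indep_var_lebesgue_integral)
  qed
  hence "has_bochner_integral M (\<lambda>\<omega>. \<Sum>i\<le>j. (X \<omega> gchoose i) * (Z \<omega> gchoose (j - i)))
      (\<Sum>i\<le>j. (a ^ i / fact i) * (b ^ (j - i) / fact (j - i)))"
    by (intro has_bochner_integral_sum)
  thus ?thesis
    by (simp only: power_over_fact_add gbinomial_Vandermonde[unfolded atLeast0AtMost])
qed

lemma (in prob_space) binomial_moment_sum_indep:
  fixes X :: "'i \<Rightarrow> 'a \<Rightarrow> real"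
  assumes "finite I" and "indep_vars (\<lambda>_. borel) X I"
    and "\<And>i j. i \<in> I \<Longrightarrow> has_bochner_integral M (\<lambda>\<omega>. X i \<omega> gchoose j) (a i ^ j / fact j)"
  shows "has_bochner_integral M (\<lambda>\<omega>. (\<Sum>i\<in>I. X i \<omega>) gchoose j) ((\<Sum>i\<in>I. a i) ^ j / fact j)"
  using assms
proof (induction I arbitrary: j rule: finite_induct)
  case empty
  show ?case
    \<comment> \<open>Both \<open>0 gchoose j\<close> and \<open>0 ^ j / fact j\<close> are 1 for
      \<open>j = 0\<close> and 0 otherwise.\<close>
    by (cases j) (simp_all add: has_bochner_integral_iff prob_space)
next
  case (insert i I)
  have "has_bochner_integral M (\<lambda>\<omega>. (\<Sum>i\<in>I. X i \<omega>) gchoose j) ((\<Sum>i\<in>I. a i) ^ j / fact j)" for j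
    using insert.prems by (intro insert.IH) (auto intro: indep_vars_subset)
  hence "has_bochner_integral M (\<lambda>\<omega>. (X i \<omega> + (\<Sum>i\<in>I. X i \<omega>)) gchoose j)
      ((a i + (\<Sum>i\<in>I. a i)) ^ j / fact j)"
    using insert by (intro binomial_moment_add_indep indep_vars_sum) auto
  thus ?case
    using insert.hyps by simp
qed

theorem theorem2p16:
  fixes M :: "'a measure"
    and Y :: "'a \<Rightarrow> nat" and Ys :: "nat \<Rightarrow> 'a \<Rightarrow> nat" and S :: "nat \<Rightarrow> 'a \<Rightarrow> nat"
    and l \<alpha> :: real and k n :: nat
  assumes "l \<noteq> 0" and "\<alpha> > 0"
    and "prob_space M"
    and "Y \<in> measurable M (count_space UNIV)"
    and "distr M (count_space UNIV) Y = measure_pmf (poisson_pmf \<alpha>)"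
    and "prob_space.indep_vars M (\<lambda>_. count_space UNIV) Ys {1..}"
    and "\<And>i. i \<ge> 1 \<Longrightarrow> distr M (count_space UNIV) (Ys i) = distr M (count_space UNIV) Y"
    and "\<And>m \<omega>. S m \<omega> = (\<Sum>i=1..m. Ys i \<omega>)"
  shows "integrable M (\<lambda>\<omega>. deg_rising_fact l (real (S k \<omega>)) n) \<and>
         prob_space.expectation M (\<lambda>\<omega>. deg_rising_fact l (real (S k \<omega>)) n)
           = prob_space.expectation M (\<lambda>\<omega>. deg_rising_fact l (real (\<Sum>i=1..k. Ys i \<omega>)) n) \<and>
         prob_space.expectation M (\<lambda>\<omega>. deg_rising_fact l (real (\<Sum>i=1..k. Ys i \<omega>)) n)
           = hetero_bell n l (real k * \<alpha>)"
proof -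
  interpret prob_space M by fact
  have moment_Ys: "has_bochner_integral M (\<lambda>\<omega>. real (Ys i \<omega>) gchoose j) (\<alpha> ^ j / fact j)"
    if "i \<ge> 1" for i j
  proof -
    have [measurable]: "Ys i \<in> measurable M (count_space UNIV)"
      using assms(6) that by (auto simp: indep_vars_def)
    have "has_bochner_integral (distr M (count_space UNIV) (Ys i))
        (\<lambda>m. real m gchoose j) (\<alpha> ^ j / fact j)"
      using poisson_binomial_moment[OF assms(2)] assms(5) assms(7)[OF that] by simp
    thus ?thesis
      by (simp add: has_bochner_integral_iff integrable_distr_eq integral_distr)
  qed
  have "indep_vars (\<lambda>_. borel) (\<lambda>i \<omega>. real (Ys i \<omega>)) {1..k}"
    by (rule indep_vars_compose2[OF indep_vars_subset[OF assms(6)]]) auto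
  hence "has_bochner_integral M (\<lambda>\<omega>. (\<Sum>i=1..k. real (Ys i \<omega>)) gchoose j)
      ((\<Sum>i=1..k. \<alpha>) ^ j / fact j)" for j
    by (intro binomial_moment_sum_indep moment_Ys) auto
  hence "has_bochner_integral M (\<lambda>\<omega>. real (S k \<omega>) gchoose j) ((real k * \<alpha>) ^ j / fact j)" for j
    by (simp add: assms(8))
  hence "has_bochner_integral M
      (\<lambda>\<omega>. \<Sum>j\<le>n. fact n * ((deg_exp_inv_neg_fps l - 1) ^ j) $ n * (real (S k \<omega>) gchoose j))
      (\<Sum>j\<le>n. fact n * ((deg_exp_inv_neg_fps l - 1) ^ j) $ n * ((real k * \<alpha>) ^ j / fact j))"
    by (intro has_bochner_integral_sum has_bochner_integral_mult_right)
  \<comment> \<open>The moments are exactly the coefficients of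
    \<open>fps_exp (real k * \<alpha>)\<close>, so the sum is the \<open>n\<close>-th coefficient of
    the composition, scaled by \<open>fact n\<close>.\<close>
  moreover have "(\<Sum>j\<le>n. fact n * ((deg_exp_inv_neg_fps l - 1) ^ j) $ n
      * ((real k * \<alpha>) ^ j / fact j)) = hetero_bell n l (real k * \<alpha>)"
    by (simp add: hetero_bell_def fps_compose_nth sum_distrib_left atLeast0AtMost mult_ac)
  ultimately have "has_bochner_integral M (\<lambda>\<omega>. deg_rising_fact l (real (S k \<omega>)) n)
      (hetero_bell n l (real k * \<alpha>))"
    by (simp add: deg_rising_fact_of_nat_conv_binomial[OF assms(1)])
  thus ?thesis
    by (simp add: has_bochner_integral_iff assms(8))
qed

end
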